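(* For every integer $m\geq 1$, the map $$f:U_m/G\to\mathrm{Graff}_1(V_m),\qquad f([C,F]):=C^{\perp}+\mathrm{span}\{F^{\perp}\},$$ is a bijection.
   Context: Let $\mathds{1}=(1,\dots,1)\in\mathbb{R}^{m+1}$ and $U_m:=\mathbb{R}^{m+1}\times(\mathbb{R}^{m+1}\setminus\mathbb{R}\cdot\mathds{1})$. Let $G$ be the group of real matrices $$\begin{bmatrix}1&b&d\\0&a&c\\0&0&1\end{bmatrix},\qquad a,b,c,d\in\mathbb{R},\ a\neq 0,$$ acting on $U_m$ by $$\begin{bmatrix}1&b&d\\0&a&c\\0&0&1\end{bmatrix}\cdot(C,F):=(C+bF+d\mathds{1},\,aF+c\mathds{1}).$$ $U_m/G$ is the set of orbits and $[C,F]$ denotes the orbit of $(C,F)\in U_m$. $V_m=\{u\in\mathbb{R}^{m+1}\mid\langle u,\mathds{1}\rangle=0\}$ is the orthogonal complement of $\mathds{1}$ for the usual inner product. For $u\in\mathbb{R}^{m+1}$, $u^\perp\in V_m$ denotes the orthogonal projection of $u$ on $V_m$. For a finite dimensional real vector space $V$, $\mathrm{Graff}_k(V)$ is the set of all $k$-dimensional affine subspaces of $V$. *)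

theory Defs
  imports "HOL-Analysis.Analysis" "HOL-Algebra.Group_Action"
begin

definition G_matrix :: "real \<Rightarrow> real \<Rightarrow> real \<Rightarrow> real \<Rightarrow> real^3^3" where
  "G_matrix a b c d = vector [vector [1, b, d], vector [0, a, c], vector [0, 0, 1]]"

definition G_group :: "(real^3^3) monoid" where
  "G_group = \<lparr>carrier = {G_matrix a b c d | a b c d. a \<noteq> 0}, mult = (**), one = mat 1\<rparr>"

text \<open>The type \<^typ>\<open>real^'n\<close> with \<^prop>\<open>CARD('n) = m + 1\<close> plays the role of
  \<open>\<real>\<^bsup>m+1\<^esup>\<close>; its constant \<^term>\<open>1 :: real^'n\<close> is the all-ones vector.\<close>

definition U_space :: "((real^'n) \<times> (real^'n)) set" where
  "U_space = UNIV \<times> (UNIV - {r *\<^sub>R 1 | r. True})"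

text \<open>The restriction to \<^const>\<open>U_space\<close> is required by the library's notion of a group action,
  whose values are extensional functions.\<close>

definition G_act :: "real^3^3 \<Rightarrow> (real^'n) \<times> (real^'n) \<Rightarrow> (real^'n) \<times> (real^'n)" where
  "G_act g = (\<lambda>(C, F) \<in> U_space.
     (C + g $ 1 $ 2 *\<^sub>R F + g $ 1 $ 3 *\<^sub>R 1, g $ 2 $ 2 *\<^sub>R F + g $ 2 $ 3 *\<^sub>R 1))"

definition V_space :: "(real^'n) set" where
  "V_space = {u. u \<bullet> 1 = 0}"

definition orth_proj :: "'a::euclidean_space set \<Rightarrow> 'a \<Rightarrow> 'a" where
  "orth_proj V u = (THE v. v \<in> V \<and> (\<forall>w\<in>V. orthogonal (u - v) w))"

definition Graff :: "nat \<Rightarrow> 'a::euclidean_space set \<Rightarrow> 'a set set" where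
  "Graff k V = {A. A \<subseteq> V \<and> affine A \<and> aff_dim A = int k}"

definition line_of :: "(real^'n) \<times> (real^'n) \<Rightarrow> (real^'n) set" where
  "line_of = (\<lambda>(C, F). (+) (orth_proj V_space C) ` span {orth_proj V_space F})"

text \<open>The value on an orbit is the common value of \<^const>\<open>line_of\<close> on its elements; that such
  a common value exists has to be proved.\<close>

definition f_map :: "((real^'n) \<times> (real^'n)) set \<Rightarrow> (real^'n) set" where
  "f_map X = the_elem (line_of ` X)"

lemma G_matrix_entries [simp]:
  "G_matrix a b c d $ 1 $ 1 = 1" "G_matrix a b c d $ 1 $ 2 = b" "G_matrix a b c d $ 1 $ 3 = d"
  "G_matrix a b c d $ 2 $ 1 = 0" "G_matrix a b c d $ 2 $ 2 = a" "G_matrix a b c d $ 2 $ 3 = c"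
  "G_matrix a b c d $ 3 $ 1 = 0" "G_matrix a b c d $ 3 $ 2 = 0" "G_matrix a b c d $ 3 $ 3 = 1"
  by (simp_all add: G_matrix_def)

lemma G_matrix_mult:
  "G_matrix a b c d ** G_matrix a' b' c' d' =
   G_matrix (a * a') (b' + b * a') (a * c' + c) (d' + b * c' + d)"
  by (simp add: vec_eq_iff forall_3 matrix_matrix_mult_def sum_3)

lemma G_matrix_one: "mat 1 = G_matrix 1 0 0 0"
  by (simp add: vec_eq_iff forall_3 mat_def)

lemma G_group_mult: "x \<otimes>\<^bsub>G_group\<^esub> y = x ** y"
  and G_group_one: "\<one>\<^bsub>G_group\<^esub> = mat 1"
  by (simp_all add: G_group_def)

lemma G_matrix_in_carrier: "a \<noteq> 0 \<Longrightarrow> G_matrix a b c d \<in> carrier G_group"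
  by (auto simp: G_group_def)

lemma group_G_group: "group G_group"
proof (rule groupI)
  fix x assume "x \<in> carrier G_group"
  then obtain a b c d where x: "x = G_matrix a b c d" and a: "a \<noteq> 0"
    by (auto simp: G_group_def)
  have "G_matrix (1 / a) (- b / a) (- c / a) (b * c / a - d) ** x = mat 1"
    using a by (simp add: x G_matrix_mult G_matrix_one field_simps)
  moreover have "G_matrix (1 / a) (- b / a) (- c / a) (b * c / a - d) \<in> carrier G_group"
    using a by (intro G_matrix_in_carrier) simp
  ultimately show "\<exists>y\<in>carrier G_group. y \<otimes>\<^bsub>G_group\<^esub> x = \<one>\<^bsub>G_group\<^esub>"
    unfolding G_group_mult G_group_one by blast
next
  show "\<one>\<^bsub>G_group\<^esub> \<in> carrier G_group"
    using G_matrix_in_carrier[of 1 0 0 0] by (simp add: G_group_def G_matrix_one)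
next
  fix x y assume "x \<in> carrier G_group" "y \<in> carrier G_group"
  then show "x \<otimes>\<^bsub>G_group\<^esub> y \<in> carrier G_group"
    by (auto simp: G_group_def G_matrix_mult) (metis mult_eq_0_iff)
qed (auto simp: G_group_def matrix_mul_assoc)

lemma U_space_closed:
  fixes F :: "real^'n"
  assumes "(C, F) \<in> U_space" "a \<noteq> 0"
  shows "(C', a *\<^sub>R F + c *\<^sub>R 1) \<in> U_space"
proof -
  have "F = (r / a - c / a) *\<^sub>R 1" if "a *\<^sub>R F + c *\<^sub>R 1 = r *\<^sub>R 1" for r
    using that assms(2) by (simp add: vec_eq_iff field_simps)
  with assms(1) show ?thesis by (auto simp: U_space_def)
qed

lemma G_act_closed:
  assumes "g \<in> carrier G_group" "p \<in> U_space"
  shows "G_act g p \<in> (U_space :: ((real^'n) \<times> (real^'n)) set)"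
  using assms by (auto simp: G_group_def G_act_def U_space_closed split: prod.splits)

lemma G_act_mult:
  assumes "g \<in> carrier G_group" "h \<in> carrier G_group" "p \<in> U_space"
  shows "G_act (g ** h) p = G_act g (G_act h p :: (real^'n) \<times> (real^'n))"
  using assms
  by (auto simp: G_group_def G_act_def U_space_closed G_matrix_mult algebra_simps split: prod.splits)

lemma G_act_one:
  assumes "p \<in> U_space"
  shows "G_act (mat 1) p = p"
  using assms by (auto simp: G_act_def G_matrix_one split: prod.splits)

lemma group_action_G_act:
  "group_action G_group (U_space :: ((real^'n) \<times> (real^'n)) set) G_act"
proof -
  interpret group G_group by (rule group_G_group)
  note m = G_group_mult and o = G_group_one
  have bij: "G_act g \<in> Bij (U_space :: ((real^'n) \<times> (real^'n)) set)"
    if g: "g \<in> carrier G_group" for g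
  proof -
    have "bij_betw (G_act g) U_space (U_space :: ((real^'n) \<times> (real^'n)) set)"
      using g by (intro bij_betw_byWitness[where f' = "G_act (inv\<^bsub>G_group\<^esub> g)"])
        (auto simp: G_act_closed simp flip: G_act_mult m, auto simp: o G_act_one)
    then show ?thesis
      by (auto simp: Bij_def G_act_def)
  qed
  have "G_act \<in> hom G_group (BijGroup (U_space :: ((real^'n) \<times> (real^'n)) set))"
  proof (rule homI)
    fix x y assume xy: "x \<in> carrier G_group" "y \<in> carrier G_group"
    have "G_act (x ** y) = compose U_space (G_act x) (G_act y :: _ \<Rightarrow> (real^'n) \<times> (real^'n))"
    proof
      fix p :: "(real^'n) \<times> (real^'n)"
      show "G_act (x ** y) p = compose U_space (G_act x) (G_act y) p"
        using xy by (cases "p \<in> U_space") (auto simp: compose_def G_act_mult, simp add: G_act_def)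
    qed
    then show "G_act (x \<otimes>\<^bsub>G_group\<^esub> y) =
        G_act x \<otimes>\<^bsub>BijGroup (U_space :: ((real^'n) \<times> (real^'n)) set)\<^esub> G_act y"
      using xy bij by (simp add: BijGroup_def m)
  qed (simp add: BijGroup_def bij)
  then show ?thesis
    by (simp add: group_action_def group_hom_def group_hom_axioms_def group_G_group group_BijGroup)
qed

end

(* The kernel of the projection onto V_space is the line spanned by 1, so modulo this line the
   group acts on pairs (C, F) by (C, F) |-> (C + b F, a F) with a nonzero. These are exactly the
   changes of base point and direction vector that leave the line through C with direction F
   unchanged. *)
theory Submission
  imports Defs
begin

lemma in_image_line_iff:
  "z \<in> (+) x ` span {y :: 'a::real_vector} \<longleftrightarrow> (\<exists>t. z = x + t *\<^sub>R y)"
  by (auto simp: span_singleton)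

text \<open>The right-hand side is the group action modulo the line spanned by \<open>1\<close>. Two
  distinct points \<open>x'\<close> and \<open>x' + y'\<close> of a line determine it, and their
  parameters on the other line yield \<open>a\<close> and \<open>b\<close>.\<close>

lemma line_eq_iff:
  fixes x y x' y' :: "'a::real_vector"
  assumes "y' \<noteq> 0"
  shows "(+) x' ` span {y'} = (+) x ` span {y} \<longleftrightarrow>
         (\<exists>a b. a \<noteq> 0 \<and> x' = x + b *\<^sub>R y \<and> y' = a *\<^sub>R y)"
proof
  assume eq: "(+) x' ` span {y'} = (+) x ` span {y}"
  have "x' \<in> (+) x' ` span {y'}" "x' + y' \<in> (+) x' ` span {y'}"
    by (auto simp: span_zero span_base)
  then obtain s t where s: "x' = x + s *\<^sub>R y" and t: "x' + y' = x + t *\<^sub>R y"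
    unfolding eq in_image_line_iff by blast
  then have "y' = (t - s) *\<^sub>R y"
    by (simp add: algebra_simps)
  \<comment> \<open>The witnesses are \<open>t - s\<close> for \<open>a\<close> and \<open>s\<close>
    for \<open>b\<close>; since \<open>y'\<close> is nonzero, so is \<open>t - s\<close>.\<close>
  with s assms show "\<exists>a b. a \<noteq> 0 \<and> x' = x + b *\<^sub>R y \<and> y' = a *\<^sub>R y"
    by (metis scaleR_zero_left)
next
  assume "\<exists>a b. a \<noteq> 0 \<and> x' = x + b *\<^sub>R y \<and> y' = a *\<^sub>R y"
  then obtain a b where a: "a \<noteq> 0" and x': "x' = x + b *\<^sub>R y" and y': "y' = a *\<^sub>R y"
    by blast
  \<comment> \<open>The parameters on the two lines correspond by the affine map taking
    \<open>t\<close> to \<open>b + t * a\<close>, which is invertible as \<open>a\<close> is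
    nonzero.\<close>
  have "x + t *\<^sub>R y = x' + ((t - b) / a) *\<^sub>R y'" for t
    using a by (simp add: x' y' flip: scaleR_add_left)
  moreover have "x' + t *\<^sub>R y' = x + (b + t * a) *\<^sub>R y" for t
    by (simp add: x' y' algebra_simps)
  ultimately show "(+) x' ` span {y'} = (+) x ` span {y}"
    unfolding set_eq_iff in_image_line_iff by blast
qed

text \<open>Translating \<open>A\<close> by one of its own points makes it a linear subspace of the
  same dimension, and a basis vector of that subspace is a direction of the line.\<close>

lemma Graff_1_iff:
  assumes V: "subspace V"
  shows "A \<in> Graff 1 V \<longleftrightarrow> (\<exists>x\<in>V. \<exists>y\<in>V. y \<noteq> 0 \<and> A = (+) x ` span {y})"
proof
  assume "A \<in> Graff 1 V"
  then have A: "A \<subseteq> V" "affine A" "aff_dim A = 1"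
    by (auto simp: Graff_def)
  then obtain x where x: "x \<in> A"
    by fastforce
  define L where "L = (+) (- x) ` A"
  have L: "subspace L"
    unfolding L_def by (rule affine_diffs_subspace[OF A(2) x])
  have "aff_dim L = 1"
    unfolding L_def aff_dim_translation_eq by (rule A(3))
  then have "dim L = 1"
    using aff_dim_subspace[OF L] by simp
  then obtain B where B: "B \<subseteq> L" "independent B" "L \<subseteq> span B" "card B = 1"
    using basis_exists[of L] by metis
  then obtain y where y: "B = {y}"
    by (auto simp: card_1_singleton_iff)
  have "L = span {y}"
    using B L y by (metis span_subspace)
  then have "A = (+) x ` span {y}"
    unfolding L_def by (metis translation_galois)
  moreover have "y \<noteq> 0"
    using B y dependent_zero by blast
  moreover have "y \<in> V"
    using B(1) A(1) x unfolding y L_def by (auto intro: subspace_diff[OF V])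
  ultimately show "\<exists>x\<in>V. \<exists>y\<in>V. y \<noteq> 0 \<and> A = (+) x ` span {y}"
    using x A(1) by blast
next
  assume "\<exists>x\<in>V. \<exists>y\<in>V. y \<noteq> 0 \<and> A = (+) x ` span {y}"
  then obtain x y where xy: "x \<in> V" "y \<in> V" "y \<noteq> 0" and A: "A = (+) x ` span {y}"
    by blast
  have "dim {y} = 1"
    using xy(3) by (simp add: dim_singleton)
  then have "aff_dim A = 1"
    by (simp add: A aff_dim_translation_eq aff_dim_subspace)
  moreover have "affine A"
    unfolding A affine_translation[symmetric] by (simp add: subspace_imp_affine)
  moreover have "A \<subseteq> V"
    using xy V by (auto simp: A in_image_line_iff subspace_add subspace_scale span_singleton)
  ultimately show "A \<in> Graff 1 V"
    by (simp add: Graff_def)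
qed

lemma subspace_V_space: "subspace V_space"
  by (auto simp: subspace_def V_space_def inner_add_left)

lemma inner_one_one: "(1 :: real^'n) \<bullet> 1 = real CARD('n)"
  by (simp add: inner_vec_def)

text \<open>Projecting onto the complement of \<open>1\<close> removes the component along
  \<open>1\<close>, whose squared norm is \<open>CARD('n)\<close>. Since the projection is defined
  by \<open>THE\<close>, uniqueness has to be shown as well.\<close>

lemma orth_proj_V_space:
  "orth_proj V_space u = u - (u \<bullet> 1 / real CARD('n)) *\<^sub>R (1 :: real^'n)"
  unfolding orth_proj_def
proof (rule the_equality)
  define p where "p = u - (u \<bullet> 1 / real CARD('n)) *\<^sub>R (1 :: real^'n)"
  have "1 \<bullet> w = 0" if "w \<in> V_space" for w :: "real^'n"
    using that by (simp add: V_space_def inner_commute)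
  then have p: "p \<in> V_space" "\<forall>w\<in>V_space. orthogonal (u - p) w"
    by (auto simp: p_def orthogonal_def) (simp add: V_space_def inner_diff_left inner_one_one)
  then show "u - (u \<bullet> 1 / real CARD('n)) *\<^sub>R 1 \<in> V_space \<and>
      (\<forall>w\<in>V_space. orthogonal (u - (u - (u \<bullet> 1 / real CARD('n)) *\<^sub>R 1)) w)"
    by (simp add: p_def)
  fix v assume v: "v \<in> V_space \<and> (\<forall>w\<in>V_space. orthogonal (u - v) w)"
  then have "v - p \<in> V_space"
    using p subspace_V_space by (blast intro: subspace_diff)
  \<comment> \<open>The difference of these two equations says that \<open>v - p\<close> is
    orthogonal to itself.\<close>
  with v p have "(u - p) \<bullet> (v - p) = 0" "(u - v) \<bullet> (v - p) = 0"
    by (auto simp: orthogonal_def)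
  then have "(v - p) \<bullet> (v - p) = 0"
    by (simp add: inner_diff_left)
  then show "v = u - (u \<bullet> 1 / real CARD('n)) *\<^sub>R 1"
    by (simp add: p_def)
qed

lemma orth_proj_V_space_in: "orth_proj V_space u \<in> V_space"
  unfolding orth_proj_V_space by (simp add: V_space_def inner_diff_left inner_one_one)

lemma orth_proj_V_space_ident: "u \<in> V_space \<Longrightarrow> orth_proj V_space u = u"
  unfolding orth_proj_V_space by (simp add: V_space_def)

lemma orth_proj_V_space_linear: "linear (orth_proj V_space :: real^'n \<Rightarrow> real^'n)"
  by (rule linearI)
    (simp_all add: orth_proj_V_space inner_add_left add_divide_distrib algebra_simps)

lemma orth_proj_V_space_eq_0_iff:
  fixes u :: "real^'n"
  shows "orth_proj V_space u = 0 \<longleftrightarrow> (\<exists>r. u = r *\<^sub>R 1)"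
  by (auto simp: orth_proj_V_space inner_one_one)

lemma orth_proj_V_space_eq_iff:
  fixes u v :: "real^'n"
  shows "orth_proj V_space u = orth_proj V_space v \<longleftrightarrow> (\<exists>r. u = v + r *\<^sub>R 1)"
  using orth_proj_V_space_eq_0_iff[of "u - v"]
  by (simp add: linear_diff[OF orth_proj_V_space_linear] algebra_simps)

text \<open>Membership in \<open>U_space\<close> is exactly what makes the projected direction span
  a line rather than a point.\<close>

lemma U_space_iff: "(C, F) \<in> U_space \<longleftrightarrow> orth_proj V_space F \<noteq> 0"
  by (auto simp: U_space_def orth_proj_V_space_eq_0_iff)

lemma in_orbit_iff:
  assumes "(C, F) \<in> U_space"
  shows "(C', F') \<in> orbit G_group G_act (C, F) \<longleftrightarrow>
    (\<exists>a b c d. a \<noteq> 0 \<and> C' = C + b *\<^sub>R F + d *\<^sub>R 1 \<and> F' = a *\<^sub>R F + c *\<^sub>R 1)"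
proof -
  have "(C', F') \<in> orbit G_group G_act (C, F) \<longleftrightarrow>
    (\<exists>a b c d. a \<noteq> 0 \<and> (C', F') = G_act (G_matrix a b c d) (C, F))"
    by (simp add: orbit_def G_group_def) metis
  then show ?thesis
    using assms by (auto simp: G_act_def)
qed

text \<open>Projecting eliminates the entries \<open>c\<close> and \<open>d\<close> of the matrix;
  the remaining \<open>a\<close> and \<open>b\<close> are the changes of direction vector and base
  point in \<open>line_eq_iff\<close>.\<close>

lemma in_orbit_iff_line_of_eq:
  assumes "p \<in> U_space" "q \<in> U_space"
  shows "q \<in> orbit G_group G_act p \<longleftrightarrow> line_of q = line_of (p :: (real^'n) \<times> (real^'n))"
proof -
  let ?P = "orth_proj V_space :: real^'n \<Rightarrow> real^'n"
  obtain C F C' F' where p: "p = (C, F)" and q: "q = (C', F')"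
    by fastforce
  \<comment> \<open>Each of \<open>d\<close> and \<open>c\<close> occurs in only one of the two
    orbit equations, so its quantifier can be treated separately; an equation up to a multiple of
    \<open>1\<close> is an equation of projections.\<close>
  have "(\<exists>r. C' = C + b *\<^sub>R F + r *\<^sub>R 1) \<longleftrightarrow> ?P C' = ?P C + b *\<^sub>R ?P F"
    and "(\<exists>r. F' = a *\<^sub>R F + r *\<^sub>R 1) \<longleftrightarrow> ?P F' = a *\<^sub>R ?P F" for a b
    by (simp_all flip: orth_proj_V_space_eq_iff
        add: linear_add[OF orth_proj_V_space_linear] linear_scale[OF orth_proj_V_space_linear])
  then show ?thesis
    using assms unfolding p q in_orbit_iff[OF assms(1)[unfolded p]] U_space_iff line_of_def
    by (simp add: line_eq_iff)
qed

text \<open>Orbits being the fibres of \<open>line_of\<close> yields both that \<open>f_map\<close>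
  is well defined and that it is injective.\<close>

lemma orbit_eq_line_of_fibre:
  fixes p :: "(real^'n) \<times> (real^'n)"
  assumes "p \<in> U_space"
  shows "orbit G_group G_act p = {q \<in> U_space. line_of q = line_of p}"
proof -
  have "orbit G_group G_act p \<subseteq> U_space"
    using assms by (auto simp: orbit_def G_act_closed)
  then show ?thesis
    using in_orbit_iff_line_of_eq[OF assms] by blast
qed

text \<open>On an orbit \<open>line_of\<close> is constant, so \<open>the_elem\<close> is applied to
  a singleton.\<close>

lemma f_map_orbit:
  fixes p :: "(real^'n) \<times> (real^'n)"
  assumes "p \<in> U_space"
  shows "f_map (orbit G_group G_act p) = line_of p"
proof -
  have "line_of ` orbit G_group G_act p = {line_of p}"
    using assms by (auto simp: orbit_eq_line_of_fibre)
  then show ?thesis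
    by (simp add: f_map_def)
qed

lemma line_of_image_U_space: "line_of ` U_space = Graff 1 (V_space :: (real^'n) set)"
proof (rule Set.set_eqI)
  fix A :: "(real^'n) set"
  show "A \<in> line_of ` U_space \<longleftrightarrow> A \<in> Graff 1 V_space"
    unfolding Graff_1_iff[OF subspace_V_space]
  proof
    assume "A \<in> line_of ` U_space"
    then obtain C F where "(C, F) \<in> U_space" "A = line_of (C, F)"
      by auto
    then show "\<exists>x\<in>V_space. \<exists>y\<in>V_space. y \<noteq> 0 \<and> A = (+) x ` span {y}"
      unfolding line_of_def case_prod_conv U_space_iff using orth_proj_V_space_in by blast
  next
    assume "\<exists>x\<in>V_space. \<exists>y\<in>V_space. y \<noteq> 0 \<and> A = (+) x ` span {y}"
    then obtain x y where "x \<in> V_space" "y \<in> V_space" "y \<noteq> 0" "A = (+) x ` span {y}"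
      by blast
    then show "A \<in> line_of ` U_space"
      \<comment> \<open>A base point and a direction already in \<open>V_space\<close> are their own
        projections, so they form a preimage themselves.\<close>
      by (intro image_eqI[of _ _ "(x, y)"])
        (auto simp: line_of_def U_space_iff orth_proj_V_space_ident)
  qed
qed

theorem proposition8p4:
  fixes m :: nat
  assumes "m \<ge> 1" and "CARD('n::finite) = m + 1"
  shows "(\<forall>(C, F) \<in> (U_space :: ((real^'n) \<times> (real^'n)) set).
            f_map (orbit G_group G_act (C, F)) =
              (+) (orth_proj V_space C) ` span {orth_proj V_space F}) \<and>
         bij_betw f_map (orbits G_group (U_space :: ((real^'n) \<times> (real^'n)) set) G_act)
           (Graff 1 V_space)"
proof
  show "\<forall>(C, F) \<in> (U_space :: ((real^'n) \<times> (real^'n)) set).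
      f_map (orbit G_group G_act (C, F)) =
        (+) (orth_proj V_space C) ` span {orth_proj V_space F}"
    using f_map_orbit by (auto simp: line_of_def)
next
  have orbits: "orbits G_group U_space G_act =
      orbit G_group G_act ` (U_space :: ((real^'n) \<times> (real^'n)) set)"
    by (auto simp: orbits_def)
  have "inj_on f_map (orbits G_group (U_space :: ((real^'n) \<times> (real^'n)) set) G_act)"
    \<comment> \<open>Equal lines have equal fibres under \<open>line_of\<close>, and these fibres
      are the orbits.\<close>
    unfolding orbits by (auto simp: inj_on_def f_map_orbit) (simp_all add: orbit_eq_line_of_fibre)
  moreover have "f_map ` orbits G_group (U_space :: ((real^'n) \<times> (real^'n)) set) G_act =
      Graff 1 V_space"
    unfolding orbits line_of_image_U_space[symmetric] image_image
    by (rule image_cong) (simp_all add: f_map_orbit)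
  ultimately show "bij_betw f_map (orbits G_group (U_space :: ((real^'n) \<times> (real^'n)) set) G_act)
      (Graff 1 V_space)"
    by (simp add: bij_betw_def)
qed

end
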